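(* Let $f$ be an entire function of genus one (in the sense of the context) such that $f(0)\neq 0$, with aperture $\kappa$, and let $N\in\mathbb{N}$. If $f$ is in the $N$-th order Laguerre-Pólya class ($N$-LP), then $$N \leq \frac{\ln\left( \frac{4\pi^2}{3}+4 \right)}{\ln 2} + \frac{\pi^3 \sqrt{3}}{\ln 2} \left(\kappa + \sqrt{1+\kappa^2} \right)^6\left(1+\kappa^2\right)^{3/2},$$ where the right-hand side is interpreted as $+\infty$ if $\kappa=\infty$.
   Context: An entire function of genus one with $f(0)\ne 0$ means a function of the form $$f(z) = e^{d_1+d_2z}\prod_{i=1}^{\infty} \left( 1 - \frac{z}{\lambda_i} \right) e^{z/\lambda_i},$$ where $d_1,d_2\in\mathbb{C}$, the $\lambda_i$ are nonzero complex numbers (the zeros of $f$ listed with multiplicity), and $\sum_i \frac{1}{|\lambda_i|^2} <\infty$. For $x\in\mathbb{R}\setminus\{\lambda_i\}$ and $n\ge 1$ put $a_n(x)=\sum_{i}\frac{1}{(\lambda_i-x)^{n+1}}$ (these are the coefficients of $(z-x)^n$ in the power series at $x$ of $-f'/f$). For $N\in\mathbb{N}$, let $A_N(x)$ be the $N\times N$ matrix with $(j,k)$ entry $a_{j+k-1}(x)$, $1\le j,k\le N$. The function $f$ is in the $N$-th order Laguerre-Pólya class ($N$-LP) if $d_2\in\mathbb{R}$ and $A_N(x)$ is positive semidefinite (in particular Hermitian) for all $x\in\mathbb{R}\setminus\{\lambda_i\}$. The spacing constant $c$ of $f$ is $c=0$ if $f$ has a repeated zero, and, if all zeros are simple, $$c=\inf_{i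 \ne j} \left\{ \left| \Re(\lambda_i-\lambda_j) \right|: \lambda_i \ne \bar{\lambda}_j \right\}.$$ The height of $f$ is $b= \inf_i \{| \Im (\lambda_i)| : \Im (\lambda_i) \neq 0\}$, with $b=\infty$ if there are no non-real zeros. The aperture of $f$ is $\kappa = b/c$ if $c\neq 0$, and $\kappa=\infty$ if $c=0$ (also $\kappa=\infty$ if $b=\infty$). *)

theory Defs
  imports
    "HOL-Analysis.Infinite_Products"
    "HOL-Library.Extended_Real"
    "Jordan_Normal_Form.Schur_Decomposition"
begin

text \<open>
  \<open>lam\<close> lists the zeros of \<open>f\<close> with multiplicity, indexed from \<open>0\<close>; every quantity below
  is unchanged by a permutation of the list. The summability condition makes the product
  converge at every \<open>z\<close>.
\<close>

definition genus_one_form ::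
    "(complex \<Rightarrow> complex) \<Rightarrow> complex \<Rightarrow> complex \<Rightarrow> (nat \<Rightarrow> complex) \<Rightarrow> bool" where
  "genus_one_form f d1 d2 lam \<longleftrightarrow>
     (\<forall>i. lam i \<noteq> 0) \<and>
     summable (\<lambda>i. 1 / (cmod (lam i))\<^sup>2) \<and>
     (\<forall>z. f z = exp (d1 + d2 * z) * (\<Prod>i. (1 - z / lam i) * exp (z / lam i)))"

definition a_coeff :: "(nat \<Rightarrow> complex) \<Rightarrow> nat \<Rightarrow> real \<Rightarrow> complex" where
  "a_coeff lam n x = (\<Sum>i. 1 / (lam i - of_real x) ^ (n + 1))"

text \<open>
  Matrix indices start at \<open>0\<close>, so the entry in row \<open>j + 1\<close> and column \<open>k + 1\<close> has
  coefficient index \<open>(j + 1) + (k + 1) - 1\<close>.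
\<close>

definition A_mat :: "(nat \<Rightarrow> complex) \<Rightarrow> nat \<Rightarrow> real \<Rightarrow> complex mat" where
  "A_mat lam N x = Matrix.mat N N (\<lambda>(j, k). a_coeff lam (j + k + 1) x)"

definition pos_semidef :: "complex mat \<Rightarrow> bool" where
  "pos_semidef A \<longleftrightarrow>
     square_mat A \<and> mat_adjoint A = A \<and>
     (\<forall>v \<in> carrier_vec (dim_row A). 0 \<le> Re ((A *\<^sub>v v) \<bullet>c v))"

text \<open>
  The class depends on \<open>f\<close> only through \<open>d2\<close> and the zeros, so these are its arguments.
\<close>

definition N_LP :: "nat \<Rightarrow> complex \<Rightarrow> (nat \<Rightarrow> complex) \<Rightarrow> bool" where
  "N_LP N d2 lam \<longleftrightarrow>
     d2 \<in> \<real> \<and> (\<forall>x::real. of_real x \<notin> range lam \<longrightarrow> pos_semidef (A_mat lam N x))"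

text \<open>
  All zeros are simple iff \<open>lam\<close> is injective. The infimum over the empty set is \<open>\<infinity>\<close>.
\<close>

definition spacing :: "(nat \<Rightarrow> complex) \<Rightarrow> ereal" where
  "spacing lam =
     (if inj lam
      then INF (i, j) \<in> {(i, j). i \<noteq> j \<and> lam i \<noteq> cnj (lam j)}. ereal \<bar>Re (lam i - lam j)\<bar>
      else 0)"

definition height :: "(nat \<Rightarrow> complex) \<Rightarrow> ereal" where
  "height lam = (INF i \<in> {i. Im (lam i) \<noteq> 0}. ereal \<bar>Im (lam i)\<bar>)"

definition aperture :: "(nat \<Rightarrow> complex) \<Rightarrow> ereal" where
  "aperture lam =
     (if spacing lam = 0 \<or> height lam = \<infinity> then \<infinity> else height lam / spacing lam)"

end

theory Submission
  imports Defs "HOL-Analysis.Harmonic_Numbers"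
begin

text \<open>
  For a polynomial \<open>P\<close> of degree less than \<open>N\<close> with real coefficients, the form of \<open>A\<^sub>N(x)\<close> at its
  coefficient vector is \<open>\<Sum>\<^sub>i (w\<^sub>i P(w\<^sub>i))\<^sup>2\<close> with \<open>w\<^sub>i = 1 / (\<lambda>\<^sub>i - x)\<close>. Take \<open>x = Re \<mu>\<close> for a non-real
  zero \<open>\<mu>\<close> whose height is close to the minimum \<open>b\<close>. A factor of \<open>P\<close> of degree one per real zero at
  distance less than \<open>sqrt (b\<^sup>2 + c\<^sup>2)\<close> from \<open>x\<close> removes the contribution of these zeros; all others
  except \<open>\<mu>\<close> and its conjugate are at least that far away, hence negligible against \<open>\<mu>\<close> once \<open>P\<close>
  contains a high power of \<open>w\<close>. Since \<open>1 / (\<mu> - x)\<close> is not real, one more real linear factor can turn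
  \<open>w P(w)\<close> at \<open>\<mu>\<close> into a purely imaginary number, so that \<open>\<mu>\<close> contributes a negative square.
  This makes the form negative as soon as \<open>N\<close> exceeds \<open>4 + 60 (1 + \<kappa>\<^sup>2)\<^sup>2\<close>.
\<close>

section \<open>Inverse-square sums over horizontally separated zeros\<close>

lemma sum_inverse_squares_le_2: "(\<Sum>k=1..n. 1 / (real k)\<^sup>2) \<le> 2"
proof -
  \<comment> \<open>The term \<open>- 1 / n\<close> makes the induction telescope:
    \<open>1 / (n + 1)^2\<close> is at most \<open>1 / n - 1 / (n + 1)\<close>.\<close>
  have "n \<ge> 1 \<Longrightarrow> (\<Sum>k=1..n. 1 / (real k)\<^sup>2) \<le> 2 - 1 / real n"
  proof (induction n rule: dec_induct)
    case base
    then show ?case by simp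
  next
    case (step n)
    then have n: "real n > 0" by simp
    have "1 / (real (Suc n))\<^sup>2 \<le> 1 / real n - 1 / real (Suc n)"
      using n by (simp add: divide_simps power2_eq_square)
    then show ?case using step by simp
  qed
  moreover have "2 - 1 / real n \<le> 2" by simp
  ultimately show ?thesis by (cases "n = 0") (simp, linarith)
qed

text \<open>Cut the line on both sides of \<open>x\<close> into intervals of length
  \<open>c\<close>. Each holds at most one zero with \<open>Im \<ge> 0\<close> and one with
  \<open>Im < 0\<close>, so at most four zeros have horizontal distance in
  \<open>[k c, (k + 1) c)\<close>. This gives \<open>4 / c^2\<close> times a partial sum of
  \<open>1 / k^2\<close>.\<close>

lemma sum_inverse_square_distances_le:
  fixes lam :: "nat \<Rightarrow> complex" and c x :: real
  assumes "inj lam" "c > 0"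
    and sep: "\<And>i j. i \<noteq> j \<Longrightarrow> lam i \<noteq> cnj (lam j) \<Longrightarrow> c \<le> \<bar>Re (lam i) - Re (lam j)\<bar>"
    and "finite F" and far: "\<And>i. i \<in> F \<Longrightarrow> c \<le> \<bar>Re (lam i) - x\<bar>"
  shows "(\<Sum>i\<in>F. 1 / (Re (lam i) - x)\<^sup>2) \<le> 8 / c\<^sup>2"
proof -
  \<comment> \<open>Two zeros with equal \<open>g\<close> have real parts closer than \<open>c\<close>, so they are conjugate.\<close>
  define k where "k i = nat \<lfloor>\<bar>Re (lam i) - x\<bar> / c\<rfloor>" for i
  define g where "g i = (k i, x \<le> Re (lam i), 0 \<le> Im (lam i))" for i
  define h :: "nat \<times> bool \<times> bool \<Rightarrow> real" where "h = (\<lambda>(n, _). 1 / (real n * c)\<^sup>2)"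
  have k: "real (k i) \<le> \<bar>Re (lam i) - x\<bar> / c" "\<bar>Re (lam i) - x\<bar> / c < real (k i) + 1" for i
  proof -
    have "\<bar>Re (lam i) - x\<bar> / c \<ge> 0" using \<open>c > 0\<close> by simp
    then show "real (k i) \<le> \<bar>Re (lam i) - x\<bar> / c" "\<bar>Re (lam i) - x\<bar> / c < real (k i) + 1"
      unfolding k_def by linarith+
  qed
  \<comment> \<open>Interval 0 is empty; there \<open>h\<close> would take the default value 0 of
    division by zero and bound nothing.\<close>
  have k1: "k i \<ge> 1" if "i \<in> F" for i
  proof -
    have "\<bar>Re (lam i) - x\<bar> / c \<ge> 1" using far[OF that] \<open>c > 0\<close> by simp
    then show ?thesis using k(2)[of i] by linarith
  qed
  have inj: "inj_on g F"
  proof (rule inj_onI, rule ccontr)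
    fix i j assume "i \<in> F" "j \<in> F" and eq: "g i = g j" and "i \<noteq> j"
    have "\<bar>\<bar>Re (lam i) - x\<bar> / c - \<bar>Re (lam j) - x\<bar> / c\<bar> < 1"
      using k[of i] k[of j] eq by (simp add: g_def)
    also have "\<bar>Re (lam i) - x\<bar> / c - \<bar>Re (lam j) - x\<bar> / c
        = (\<bar>Re (lam i) - x\<bar> - \<bar>Re (lam j) - x\<bar>) / c"
      by (simp add: diff_divide_distrib)
    finally have "\<bar>\<bar>Re (lam i) - x\<bar> - \<bar>Re (lam j) - x\<bar>\<bar> < c"
      using \<open>c > 0\<close> by (simp add: abs_divide)
    then have "\<bar>Re (lam i) - Re (lam j)\<bar> < c" using eq by (auto simp: g_def)
    then have cn: "lam i = cnj (lam j)" using sep[OF \<open>i \<noteq> j\<close>] by force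
    then have "Im (lam i) = - Im (lam j)" by simp
    moreover have "0 \<le> Im (lam i) \<longleftrightarrow> 0 \<le> Im (lam j)" using eq by (simp add: g_def)
    ultimately have "Im (lam j) = 0" by linarith
    then have "lam i = lam j" using cn by (simp add: complex_eq_iff)
    then show False using \<open>i \<noteq> j\<close> \<open>inj lam\<close> by (auto dest: injD)
  qed
  define M where "M = Max (k ` F)"
  have sub: "g ` F \<subseteq> {1..M} \<times> (UNIV :: (bool \<times> bool) set)"
    using k1 \<open>finite F\<close> by (auto simp: g_def M_def)
  have "(\<Sum>i\<in>F. 1 / (Re (lam i) - x)\<^sup>2) \<le> (\<Sum>i\<in>F. h (g i))"
  proof (rule sum_mono)
    fix i assume i: "i \<in> F"
    have "real (k i) * c \<le> \<bar>Re (lam i) - x\<bar>" using k(1)[of i] \<open>c > 0\<close> by (simp add: field_simps)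
    then have "(real (k i) * c)\<^sup>2 \<le> (Re (lam i) - x)\<^sup>2"
      using \<open>c > 0\<close> by (metis abs_le_square_iff abs_of_nonneg less_imp_le mult_nonneg_nonneg of_nat_0_le_iff)
    moreover have "(real (k i) * c)\<^sup>2 > 0" using k1[OF i] \<open>c > 0\<close> by simp
    ultimately show "1 / (Re (lam i) - x)\<^sup>2 \<le> h (g i)"
      by (simp add: h_def g_def frac_le)
  qed
  also have "\<dots> = sum h (g ` F)" using inj by (simp add: sum.reindex)
  also have "\<dots> \<le> sum h ({1..M} \<times> UNIV)"
    using sub by (intro sum_mono2) (auto simp: h_def)
  also have "\<dots> = (\<Sum>n=1..M. \<Sum>y\<in>(UNIV :: (bool \<times> bool) set). 1 / (real n * c)\<^sup>2)"
    unfolding h_def sum.cartesian_product by (simp add: case_prod_unfold)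
  also have "\<dots> = (\<Sum>n=1..M. 4 / c\<^sup>2 * (1 / (real n)\<^sup>2))"
    by (simp add: UNIV_Times_UNIV[symmetric] card_cartesian_product power_mult_distrib
        del: UNIV_Times_UNIV) (simp add: mult.commute)
  also have "\<dots> = 4 / c\<^sup>2 * (\<Sum>n=1..M. 1 / (real n)\<^sup>2)" by (simp only: sum_distrib_left)
  also have "\<dots> \<le> 4 / c\<^sup>2 * 2"
    using sum_inverse_squares_le_2 by (intro mult_left_mono) auto
  finally show ?thesis by simp
qed

section \<open>Real polynomials and the quadratic form of \<open>A_mat\<close>\<close>

definition real_poly :: "complex poly \<Rightarrow> bool" where
  "real_poly p \<longleftrightarrow> (\<forall>n. coeff p n \<in> \<real>)"

lemma real_poly_mult: "real_poly p \<Longrightarrow> real_poly q \<Longrightarrow> real_poly (p * q)"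
  by (simp add: real_poly_def coeff_mult)

lemma real_poly_prod: "(\<And>i. i \<in> A \<Longrightarrow> real_poly (p i)) \<Longrightarrow> real_poly (\<Prod>i\<in>A. p i)"
  by (induction A rule: infinite_finite_induct) 
    (simp_all add: real_poly_mult, simp_all add: real_poly_def coeff_1)

lemma poly_cnj_real_poly: "real_poly p \<Longrightarrow> poly p (cnj z) = cnj (poly p z)"
  by (simp add: real_poly_def poly_altdef Reals_cnj_iff)

text \<open>Almost all \<open>w i\<close> lie in the unit disc, so higher powers are dominated by
  squares. This justifies exchanging the sum over the zeros with the finite sums of the quadratic
  form.\<close>

lemma summable_power_of_summable_norm_square:
  fixes w :: "nat \<Rightarrow> complex"
  assumes "summable (\<lambda>i. (cmod (w i))\<^sup>2)"
  shows "summable (\<lambda>i. w i ^ (n + 2))"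
proof (induction n)
  case 0
  show ?case by (rule summable_norm_cancel) (use assms in \<open>simp add: norm_mult power2_eq_square\<close>)
next
  case (Suc n)
  have "(\<lambda>i. (cmod (w i))\<^sup>2) \<longlonglongrightarrow> 0" by (rule summable_LIMSEQ_zero[OF assms])
  then have "eventually (\<lambda>i. (cmod (w i))\<^sup>2 < 1) sequentially"
    by (rule order_tendstoD) simp
  then have "eventually (\<lambda>i. norm (w i ^ (Suc n + 2)) \<le> (cmod (w i))\<^sup>2) sequentially"
  proof eventually_elim
    case (elim i)
    then have "cmod (w i) \<le> 1" by (simp add: power_less_one_iff abs_square_less_1)
    then show ?case unfolding norm_power by (intro power_decreasing) auto
  qed
  then show ?case by (rule summable_comparison_test_ev[OF _ assms])
qed

text \<open>With indices from 0, the entry at \<open>(j, k)\<close> is the power sum of the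
  \<open>w i\<close> with exponent \<open>j + k + 2\<close>, so the form factors zero by zero. Real
  coefficients make the conjugation in \<open>\<bullet>c\<close> harmless: squares appear instead of
  squared moduli, and these can be negative.\<close>

lemma A_mat_quadratic_form:
  fixes lam :: "nat \<Rightarrow> complex" and x :: real and P :: "complex poly"
  defines "w \<equiv> \<lambda>i. 1 / (lam i - of_real x)"
  assumes summ: "summable (\<lambda>i. (cmod (w i))\<^sup>2)"
    and psd: "pos_semidef (A_mat lam N x)"
    and real: "real_poly P" and deg: "degree P < N"
  shows "summable (\<lambda>i. (w i * poly P (w i))\<^sup>2)"
    and "0 \<le> Re (\<Sum>i. (w i * poly P (w i))\<^sup>2)"
proof -
  have expand: "(w i * poly P (w i))\<^sup>2
      = (\<Sum>j<N. \<Sum>k<N. coeff P j * coeff P k * w i ^ (j + k + 2))" for i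
  proof -
    have "poly P (w i) = (\<Sum>j<N. coeff P j * w i ^ j)"
      unfolding poly_altdef using deg
      by (intro sum.mono_neutral_left) (auto simp: coeff_eq_0)
    then have "(w i * poly P (w i))\<^sup>2
        = (w i)\<^sup>2 * ((\<Sum>j<N. coeff P j * w i ^ j) * (\<Sum>k<N. coeff P k * w i ^ k))"
      by (simp add: power2_eq_square)
    also have "\<dots> = (\<Sum>j<N. \<Sum>k<N. coeff P j * coeff P k * w i ^ (j + k + 2))"
      unfolding sum_product
      by (simp add: sum_distrib_left power_add power2_eq_square mult_ac)
    finally show ?thesis .
  qed
  have s: "summable (\<lambda>i. w i ^ (n + 2))" for n using summable_power_of_summable_norm_square[OF summ] .
  show "summable (\<lambda>i. (w i * poly P (w i))\<^sup>2)"
    unfolding expand by (intro summable_sum summable_mult s)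
  define v where "v = vec N (\<lambda>j. coeff P j)"
  have v: "v \<in> carrier_vec N" by (simp add: v_def)
  have "(A_mat lam N x *\<^sub>v v) \<bullet>c v
      = (\<Sum>j<N. (\<Sum>k<N. a_coeff lam (j + k + 1) x * coeff P k) * coeff P j)"
    using real by (auto simp: scalar_prod_def v_def A_mat_def real_poly_def Reals_cnj_iff
        lessThan_atLeast0 intro!: sum.cong)
  also have "\<dots> = (\<Sum>j<N. \<Sum>k<N. coeff P j * coeff P k * a_coeff lam (j + k + 1) x)"
    by (simp add: sum_distrib_right sum_distrib_left mult_ac)
  also have "\<dots> = (\<Sum>j<N. \<Sum>k<N. coeff P j * coeff P k * (\<Sum>i. w i ^ (j + k + 2)))"
    by (simp add: a_coeff_def w_def power_one_over)
  also have "\<dots> = (\<Sum>j<N. \<Sum>k<N. \<Sum>i. coeff P j * coeff P k * w i ^ (j + k + 2))"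
    by (subst suminf_mult[OF s]) simp
  also have "\<dots> = (\<Sum>j<N. \<Sum>i. \<Sum>k<N. coeff P j * coeff P k * w i ^ (j + k + 2))"
    by (intro sum.cong refl suminf_sum[symmetric] summable_mult s)
  also have "\<dots> = (\<Sum>i. (w i * poly P (w i))\<^sup>2)"
    unfolding expand by (intro suminf_sum[symmetric] summable_sum summable_mult s)
  finally have "(A_mat lam N x *\<^sub>v v) \<bullet>c v = (\<Sum>i. (w i * poly P (w i))\<^sup>2)" .
  moreover have "0 \<le> Re ((A_mat lam N x *\<^sub>v v) \<bullet>c v)"
    using psd v by (auto simp: pos_semidef_def A_mat_def)
  ultimately show "0 \<le> Re (\<Sum>i. (w i * poly P (w i))\<^sup>2)" by simp
qed

section \<open>The numerical estimate\<close>

text \<open>Here \<open>y\<close> stands for the squared height of the chosen zero and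
  \<open>z\<close> for a lower bound on the squared distance of the far zeros. The left side bounds
  their total contribution, the right side is a lower bound for that of the chosen zero. The gap
  \<open>c^2 / 2\<close> between \<open>y\<close> and \<open>z\<close> makes
  \<open>(y / z)^m\<close> decay exponentially.\<close>

lemma far_zeros_dominated:
  fixes \<tau> y z c :: real and m s :: nat
  assumes tau: "\<tau> \<ge> 1" and "c > 0" and y: "0 < y" "y \<le> (\<tau> - 1 / 2) * c\<^sup>2"
    and z: "z = \<tau> * c\<^sup>2"
    and s: "real s \<le> 8 * \<tau>" and m: "real m \<ge> 52 * \<tau>\<^sup>2"
  shows "4 ^ (s + 1) * (1 / z) ^ m * (8 / c\<^sup>2) < (1 / y) ^ (m + 1)"
proof -
  have zpos: "z > 0" using z tau \<open>c > 0\<close> by simp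
  have "y / z \<le> (\<tau> - 1 / 2) * c\<^sup>2 / z" using y zpos by (intro divide_right_mono) auto
  also have "\<dots> = 1 - 1 / (2 * \<tau>)"
    using z tau \<open>c > 0\<close> by (simp add: field_simps)
  also have "\<dots> \<le> exp (- (1 / (2 * \<tau>)))"
    using exp_ge_add_one_self[of "- (1 / (2 * \<tau>))"] by simp
  finally have "(y / z) ^ m \<le> exp (- (1 / (2 * \<tau>))) ^ m"
    using y zpos by (intro power_mono) auto
  also have "\<dots> = exp (- (real m / (2 * \<tau>)))" by (simp add: exp_of_nat_mult[symmetric])
  also have "\<dots> \<le> exp (- (26 * \<tau>))"
    using m tau by (simp add: field_simps power2_eq_square)
  finally have 1: "(y / z) ^ m \<le> exp (- (26 * \<tau>))" .
  have e1: "(2::real) \<le> exp 1" using exp_ge_add_one_self[of 1] by simp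
  have e2: "(4::real) \<le> exp 2"
    using mult_mono[OF e1 e1] by (simp add: exp_add[symmetric])
  have e3: "(8::real) \<le> exp 3"
    using mult_mono[OF e1 e2] by (simp add: exp_add[symmetric])
  have "(4::real) ^ (s + 1) \<le> exp 2 ^ (s + 1)" by (intro power_mono e2) auto
  also have "\<dots> = exp (2 * real (s + 1))"
    by (subst exp_of_nat_mult[symmetric]) (simp add: mult.commute)
  also have "\<dots> \<le> exp (18 * \<tau>)" using s tau by simp
  finally have 2: "(4::real) ^ (s + 1) \<le> exp (18 * \<tau>)" .
  have "y / c\<^sup>2 \<le> \<tau> - 1 / 2" using y \<open>c > 0\<close> by (simp add: field_simps)
  also have "\<dots> \<le> exp \<tau>" using exp_ge_add_one_self[of \<tau>] by linarith
  finally have "8 * (y / c\<^sup>2) \<le> exp 3 * exp \<tau>"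
    using e3 y by (intro mult_mono) auto
  also have "\<dots> \<le> exp (4 * \<tau>)" using tau by (simp add: exp_add[symmetric])
  finally have 3: "8 * (y / c\<^sup>2) \<le> exp (4 * \<tau>)" .
  \<comment> \<open>The constant 52 gives the exponent 26, which exceeds 18 + 4.\<close>
  have "4 ^ (s + 1) * (y / z) ^ m * (8 * (y / c\<^sup>2))
      \<le> exp (18 * \<tau>) * exp (- (26 * \<tau>)) * exp (4 * \<tau>)"
    using y zpos by (intro mult_mono 1 2 3) auto
  also have "\<dots> = exp (- (4 * \<tau>))" by (simp add: exp_add[symmetric])
  also have "\<dots> < 1" using tau by simp
  finally have "4 ^ (s + 1) * (y / z) ^ m * (8 * (y / c\<^sup>2)) < 1" .
  then have "(1 / y) ^ (m + 1) * (4 ^ (s + 1) * (y / z) ^ m * (8 * (y / c\<^sup>2)))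
      < (1 / y) ^ (m + 1) * 1" using y by (intro mult_strict_left_mono) auto
  also have "(1 / y) ^ (m + 1) * (4 ^ (s + 1) * (y / z) ^ m * (8 * (y / c\<^sup>2)))
      = 4 ^ (s + 1) * (1 / z) ^ m * (8 / c\<^sup>2)"
    using y zpos \<open>c > 0\<close> by (simp add: power_divide field_simps)
  finally show ?thesis by simp
qed

section \<open>A test polynomial that makes the form negative\<close>

text \<open>The bound is a degree count: at most \<open>8 \<tau>\<close> factors cancel near real
  zeros, and a power \<open>m \<ge> 52 \<tau>^2\<close> suppresses the far ones; both fit once
  \<open>N > 4 + 60 \<tau>^2\<close>.\<close>

lemma N_le_of_pos_semidef:
  fixes lam :: "nat \<Rightarrow> complex" and b c :: real and N i0 :: nat
  defines "\<tau> \<equiv> 1 + (b / c)\<^sup>2"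
  assumes "inj lam" "c > 0" "b \<ge> 0"
    and sep: "\<And>i j. i \<noteq> j \<Longrightarrow> lam i \<noteq> cnj (lam j) \<Longrightarrow> c \<le> \<bar>Re (lam i) - Re (lam j)\<bar>"
    and high: "\<And>i. Im (lam i) \<noteq> 0 \<Longrightarrow> b \<le> \<bar>Im (lam i)\<bar>"
    and i0: "Im (lam i0) \<noteq> 0" "(Im (lam i0))\<^sup>2 \<le> b\<^sup>2 + c\<^sup>2 / 2"
    and psd: "\<And>x. of_real x \<notin> range lam \<Longrightarrow> pos_semidef (A_mat lam N x)"
  shows "real N \<le> 4 + 60 * \<tau>\<^sup>2"
proof (rule ccontr)
  assume "\<not> ?thesis"
  then have N: "real N > 4 + 60 * \<tau>\<^sup>2" by simp
  have tau: "\<tau> \<ge> 1" by (simp add: \<tau>_def)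
  then have tau_sq: "\<tau>\<^sup>2 \<ge> \<tau>" by (simp add: self_le_power)
  define x where "x = Re (lam i0)"
  define v where "v = Im (lam i0)"
  define z where "z = b\<^sup>2 + c\<^sup>2"
  define r where "r i = Re (lam i) - x" for i
  \<comment> \<open>\<open>lam i0\<close> occurs once, but its conjugate need not be in the list.\<close>
  define E where "E = {i. lam i \<noteq> lam i0 \<and> lam i \<noteq> cnj (lam i0)}"
  define w where "w i = 1 / (lam i - of_real x)" for i
  \<comment> \<open>A summable majorant of the squared moduli of \<open>w\<close> on
    \<open>E\<close>, using horizontal distance only.\<close>
  define e where "e i = (if i \<in> E then 1 / (r i)\<^sup>2 else 0)" for i
  \<comment> \<open>Only real zeros of \<open>E\<close> can be closer to \<open>x\<close> than
    \<open>sqrt z\<close>: a non-real one has height at least \<open>b\<close> and horizontal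
    distance at least \<open>c\<close>.\<close>
  define K where "K = {i \<in> E. Im (lam i) = 0 \<and> (r i)\<^sup>2 < z}"
  have z: "z > 0" "z = \<tau> * c\<^sup>2" using \<open>c > 0\<close>
    by (auto simp: z_def \<tau>_def field_simps intro: add_nonneg_pos)
  have v: "v \<noteq> 0" "v\<^sup>2 \<le> z" using i0 by (auto simp: v_def z_def intro: order_trans)
  have lam_i0: "lam i0 - of_real x = \<i> * of_real v"
    by (simp add: complex_eq_iff x_def v_def)
  have notE: "lam i = lam i0 \<or> lam i = cnj (lam i0)" if "i \<notin> E" for i
    using that by (auto simp: E_def)
  have far: "c \<le> \<bar>r i\<bar>" if "i \<in> E" for i
    unfolding r_def x_def using that by (intro sep) (auto simp: E_def)
  then have r_nz: "r i \<noteq> 0" if "i \<in> E" for i using that \<open>c > 0\<close> by force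
  have x: "of_real x \<notin> range lam"
  proof
    assume "of_real x \<in> range lam"
    then obtain i where i: "lam i = of_real x" by auto
    then have "i \<notin> E" using r_nz[of i] by (auto simp: r_def)
    then have "of_real x = lam i0 \<or> of_real x = cnj (lam i0)" using notE i by metis
    then have "Im (lam i0) = 0" by (auto simp: complex_eq_iff)
    then show False using i0 by simp
  qed
  have sumE: "(\<Sum>i\<in>F. 1 / (r i)\<^sup>2) \<le> 8 / c\<^sup>2" if "finite F" "F \<subseteq> E" for F
    unfolding r_def
    by (rule sum_inverse_square_distances_le[OF \<open>inj lam\<close> \<open>c > 0\<close> sep])
      (use that far in \<open>auto simp: r_def\<close>)

  \<comment> \<open>Each zero in \<open>K\<close> adds more than \<open>1 / z\<close> to sums
    bounded by \<open>8 / c^2\<close>, so finite subsets of \<open>K\<close> have at most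
    \<open>8 z / c^2 = 8 \<tau>\<close> elements.\<close>
  have K: "finite K \<and> card K \<le> nat \<lfloor>8 * \<tau>\<rfloor>"
  proof (rule finite_if_finite_subsets_card_bdd)
    fix G assume G: "G \<subseteq> K" "finite G"
    have "real (card G) = (\<Sum>i\<in>G. 1)" by simp
    also have "\<dots> \<le> (\<Sum>i\<in>G. z * (1 / (r i)\<^sup>2))"
    proof (rule sum_mono)
      fix i assume "i \<in> G"
      then have "i \<in> E" "(r i)\<^sup>2 < z" using G by (auto simp: K_def)
      then show "1 \<le> z * (1 / (r i)\<^sup>2)" using r_nz by simp
    qed
    also have "\<dots> = z * (\<Sum>i\<in>G. 1 / (r i)\<^sup>2)" by (simp only: sum_distrib_left)
    also have "\<dots> \<le> z * (8 / c\<^sup>2)"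
      using G z by (intro mult_left_mono sumE) (auto simp: K_def)
    also have "\<dots> = 8 * \<tau>" using z \<open>c > 0\<close> by simp
    finally show "card G \<le> nat \<lfloor>8 * \<tau>\<rfloor>" using tau by (simp add: le_nat_floor)
  qed
  define s where "s = card K"
  have s: "real s \<le> 8 * \<tau>" using K tau by (simp add: s_def) linarith
  \<comment> \<open>Degree budget: \<open>m\<close> for the monomial, \<open>s\<close> for the
    factors that vanish at \<open>K\<close>, one for the linear factor \<open>L\<close>, in total
    \<open>N - 1\<close>.\<close>
  define m where "m = N - 2 - s"
  have Ns: "real N > 4 + real s" using N s tau tau_sq by linarith
  then have "N = m + 2 + s" unfolding m_def by linarith
  then have "real N = real m + 2 + real s" by simp
  then have m: "real m \<ge> 52 * \<tau>\<^sup>2" using N s tau tau_sq by linarith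

  have e_nonneg: "e i \<ge> 0" for i by (simp add: e_def)
  have e_partial: "sum e {..<n} \<le> 8 / c\<^sup>2" for n
  proof -
    have "sum e {..<n} = (\<Sum>i\<in>{..<n} \<inter> E. 1 / (r i)\<^sup>2)"
      unfolding e_def by (rule sum.inter_restrict[symmetric]) simp
    also have "\<dots> \<le> 8 / c\<^sup>2" by (rule sumE) auto
    finally show ?thesis .
  qed
  have e_summable: "summable e" by (rule summableI_nonneg_bounded[OF e_nonneg e_partial])
  have e_suminf: "suminf e \<le> 8 / c\<^sup>2" by (rule suminf_le_const[OF e_summable e_partial])

  have w_sq: "(cmod (w i))\<^sup>2 = 1 / ((r i)\<^sup>2 + (Im (lam i))\<^sup>2)" for i
    by (simp add: w_def norm_divide power_divide cmod_power2 r_def)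
  have w_le: "(cmod (w i))\<^sup>2 \<le> e i" if "i \<in> E" for i
    using that r_nz[OF that] by (simp add: w_sq e_def frac_le)
  \<comment> \<open>By injectivity at most two indices lie outside \<open>E\<close>.\<close>
  have w_summable: "summable (\<lambda>i. (cmod (w i))\<^sup>2)"
  proof (rule summable_comparison_test_ev[OF _ e_summable])
    have "finite (lam -` {lam i0, cnj (lam i0)})" using \<open>inj lam\<close> by (intro finite_vimageI) auto
    then have "finite {i. i \<notin> E}" by (rule rev_finite_subset) (auto simp: E_def)
    then have "eventually (\<lambda>i. i \<in> E) sequentially"
      by (simp add: eventually_cofinite flip: cofinite_eq_sequentially)
    then show "eventually (\<lambda>i. norm ((cmod (w i))\<^sup>2) \<le> e i) sequentially"
      by eventually_elim (simp add: w_le)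
  qed

  define T where "T = w i0"
  have T: "T = - \<i> / of_real v" 
    using v by (simp add: T_def w_def lam_i0 complex_eq_iff Re_divide Im_divide power2_eq_square)
  \<comment> \<open>The factor of index \<open>i\<close> vanishes at \<open>w i = 1 / r i\<close>,
    since zeros in \<open>K\<close> are real.\<close>
  define R where "R u = (\<Prod>i\<in>K. 1 - of_real (r i) * u)" for u :: complex
  define Z where "Z = T ^ (m + 1) * R T"
  \<comment> \<open>\<open>T\<close> is purely imaginary, so every factor of \<open>R T\<close> has
    real part 1 and the cancelling factors do not shrink the contribution of
    \<open>lam i0\<close>.\<close>
  have "cmod (R T) \<ge> 1"
    unfolding R_def prod_norm[symmetric]
  proof (rule prod_ge_1)
    fix i
    have "Re (1 - of_real (r i) * T) = 1" by (simp add: T)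
    then show "1 \<le> cmod (1 - of_real (r i) * T)" by (metis complex_Re_le_cmod)
  qed
  moreover have "(cmod T)\<^sup>2 = 1 / v\<^sup>2" by (simp add: T norm_divide power_divide)
  moreover have "(cmod Z)\<^sup>2 = ((cmod T)\<^sup>2) ^ (m + 1) * (cmod (R T))\<^sup>2"
    by (simp only: Z_def norm_mult norm_power power_mult_distrib power_mult[symmetric] mult.commute)
  ultimately have Z: "(cmod Z)\<^sup>2 \<ge> (1 / v\<^sup>2) ^ (m + 1)"
    using mult_left_mono[of 1 "(cmod (R T))\<^sup>2" "(1 / v\<^sup>2) ^ (m + 1)"] by simp
  moreover have "(1 / v\<^sup>2) ^ (m + 1) > 0" using v by simp
  ultimately have Z_nz: "Z \<noteq> 0" by force
  \<comment> \<open>\<open>L\<close> is the real linear factor with \<open>L T * Z\<close> a positive multiple of \<open>\<i>\<close>.\<close>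
  define \<zeta> where "\<zeta> = \<i> * of_real (cmod Z) / Z"
  have zeta: "cmod \<zeta> = 1" using Z_nz by (simp add: \<zeta>_def norm_divide norm_mult)
  define L where "L u = of_real (Re \<zeta>) + of_real (- v * Im \<zeta>) * u" for u :: complex
  have LT: "L T = \<zeta>" using v by (simp add: L_def T complex_eq_iff)
  define P :: "complex poly" where "P = monom 1 m * (\<Prod>i\<in>K. [:1, - of_real (r i):])
    * [:of_real (Re \<zeta>), of_real (- v * Im \<zeta>):]"
  have real_linear: "real_poly [:of_real p, of_real q:]" for p q :: real
    by (auto simp: real_poly_def coeff_pCons split: nat.splits)
  have real: "real_poly P"
    unfolding P_def
  proof (intro real_poly_mult real_poly_prod real_linear)
    show "real_poly (monom 1 m)" by (simp add: real_poly_def)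
    show "real_poly [:1, - of_real (r i):]" for i
      using real_linear[of 1 "- r i"] by simp
  qed
  have deg: "degree P < N"
  proof -
    have "degree (\<Prod>i\<in>K. [:1, - of_real (r i) :: complex:])
        \<le> (\<Sum>i\<in>K. degree [:1, - of_real (r i) :: complex:])"
      using degree_prod_sum_le[of K "\<lambda>i. [:1, - of_real (r i) :: complex:]"] K by (simp add: o_def)
    also have "\<dots> \<le> (\<Sum>i\<in>K. 1)" by (intro sum_mono) auto
    finally have "degree (\<Prod>i\<in>K. [:1, - of_real (r i) :: complex:]) \<le> s" by (simp add: s_def)
    then have "degree (monom 1 m * (\<Prod>i\<in>K. [:1, - of_real (r i) :: complex:])) \<le> m + s"
      by (intro order_trans[OF degree_mult_le] add_mono degree_monom_le)
    moreover have "degree [:complex_of_real (Re \<zeta>), of_real (- v * Im \<zeta>):] \<le> 1" by simp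
    ultimately have "degree P \<le> m + s + 1"
      unfolding P_def by (rule order_trans[OF degree_mult_le add_mono])
    then show ?thesis using \<open>N = m + 2 + s\<close> by simp
  qed
  have P: "u * poly P u = u ^ (m + 1) * R u * L u" for u
    by (simp add: P_def R_def L_def poly_monom poly_prod algebra_simps)
  define S where "S i = (w i * poly P (w i))\<^sup>2" for i
  have S_summable: "summable S" and S_nonneg: "0 \<le> Re (suminf S)"
    unfolding S_def w_def
    by (rule A_mat_quadratic_form[OF _ psd[OF x] real deg], use w_summable in \<open>simp add: w_def\<close>)+
  have S0: "S i0 = - of_real ((cmod Z)\<^sup>2)"
    using Z_nz unfolding S_def P T_def[symmetric] Z_def[symmetric] LT
    by (simp add: \<zeta>_def power_mult_distrib)

  \<comment> \<open>Squared moduli are at most 4 for each of the \<open>s\<close> factors of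
    \<open>R\<close> and for \<open>L\<close>. Of the \<open>m + 1\<close> factors
    \<open>(cmod (w i))^2\<close>, \<open>m\<close> are bounded by \<open>1 / z\<close> and the last
    by \<open>e i\<close>, to keep the sum convergent.\<close>
  define C where "C = 4 ^ (s + 1) * (1 / z) ^ m"
  have C: "C \<ge> 0" using z by (simp add: C_def)
  have bound: "Re (S i) \<le> C * e i" if "i \<in> E" for i
  proof (cases "i \<in> K")
    case True
    then have "lam i - of_real x = of_real (r i)" by (simp add: complex_eq_iff r_def K_def)
    then have "1 - of_real (r i) * w i = 0" using r_nz[OF that] by (simp add: w_def)
    then have "R (w i) = 0" unfolding R_def using K True by (auto simp: prod_zero_iff)
    then show ?thesis using C e_nonneg by (simp add: S_def P)
  next
    case False
    have "z \<le> (r i)\<^sup>2 + (Im (lam i))\<^sup>2"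
    proof (cases "Im (lam i) = 0")
      case True
      then show ?thesis using False that by (simp add: K_def)
    next
      case False
      then have "b\<^sup>2 \<le> (Im (lam i))\<^sup>2" using high \<open>b \<ge> 0\<close> by (simp add: abs_le_square_iff[symmetric])
      moreover have "c\<^sup>2 \<le> (r i)\<^sup>2" using far[OF that] \<open>c > 0\<close> by (simp add: abs_le_square_iff[symmetric])
      ultimately show ?thesis by (simp add: z_def)
    qed
    then have wz: "(cmod (w i))\<^sup>2 \<le> 1 / z" using z by (simp add: w_sq frac_le)
    \<comment> \<open>Used with \<open>t = r j\<close> for \<open>j\<close> in \<open>K\<close> to
      bound \<open>R\<close>, and with \<open>t = v\<close> to bound \<open>L\<close>.\<close>
    have le1: "\<bar>t\<bar> * cmod (w i) \<le> 1" if "t\<^sup>2 \<le> z" for t :: real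
    proof -
      have "(\<bar>t\<bar> * cmod (w i))\<^sup>2 \<le> z * (1 / z)"
        unfolding power_mult_distrib using that wz z by (intro mult_mono) auto
      also have "\<dots> = 1\<^sup>2" using z(1) by simp
      finally show ?thesis by (rule power2_le_imp_le) simp
    qed
    have "cmod (R (w i)) \<le> (\<Prod>i\<in>K. 2)"
      unfolding R_def prod_norm[symmetric]
    proof (rule prod_mono, intro conjI norm_ge_zero)
      fix j assume "j \<in> K"
      then have "\<bar>r j\<bar> * cmod (w i) \<le> 1" by (intro le1) (simp add: K_def)
      then show "cmod (1 - of_real (r j) * w i) \<le> 2"
        using norm_triangle_ineq4[of 1 "of_real (r j) * w i"] by (simp add: norm_mult)
    qed
    then have "cmod (R (w i)) \<le> 2 ^ s" by (simp add: s_def)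
    then have "(cmod (R (w i)))\<^sup>2 \<le> (2 ^ s)\<^sup>2" by (intro power_mono) auto
    also have "\<dots> = (2\<^sup>2) ^ s" by (simp only: power_mult[symmetric] mult.commute)
    finally have R2: "(cmod (R (w i)))\<^sup>2 \<le> 4 ^ s" by simp
    have "cmod (L (w i)) \<le> \<bar>Re \<zeta>\<bar> + \<bar>Im \<zeta>\<bar> * (\<bar>v\<bar> * cmod (w i))"
      unfolding L_def by (rule order_trans[OF norm_triangle_ineq]) (simp add: norm_mult)
    also have "\<dots> \<le> 1 + 1 * 1"
      using abs_Re_le_cmod[of \<zeta>] abs_Im_le_cmod[of \<zeta>] zeta le1[OF v(2)]
      by (intro add_mono mult_mono) auto
    finally have L2: "(cmod (L (w i)))\<^sup>2 \<le> 4"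
      using power_mono[of "cmod (L (w i))" 2 2] by simp
    have "cmod (S i) = ((cmod (w i))\<^sup>2) ^ m * (cmod (w i))\<^sup>2 * (cmod (R (w i)))\<^sup>2 * (cmod (L (w i)))\<^sup>2"
      unfolding S_def P
      by (simp add: norm_mult norm_power power_mult_distrib power_add power2_eq_square mult_ac)
    also have "\<dots> \<le> (1 / z) ^ m * e i * 4 ^ s * 4"
      using wz w_le[OF that] R2 L2 z e_nonneg by (intro mult_mono power_mono) auto
    also have "\<dots> = C * e i" by (simp add: C_def)
    finally show ?thesis using complex_Re_le_cmod[of "S i"] by linarith
  qed
  have outside: "Re (S i) = - (cmod Z)\<^sup>2" if "i \<notin> E" for i
    using notE[OF that]
  proof
    assume "lam i = lam i0"
    then have "S i = S i0" by (simp add: S_def w_def)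
    then show ?thesis by (simp add: S0)
  next
    assume "lam i = cnj (lam i0)"
    then have "w i = cnj (w i0)" by (simp add: w_def)
    then have "S i = cnj (S i0)" by (simp add: S_def poly_cnj_real_poly[OF real])
    then show ?thesis by (simp add: S0)
  qed
  \<comment> \<open>Only \<open>i0\<close> keeps its negative term. If the conjugate is listed, its
    negative term is bounded by 0, so both cases are covered.\<close>
  define h where "h i = C * e i + (if i = i0 then - (cmod Z)\<^sup>2 else 0)" for i
  have "Re (S i) \<le> h i" for i
    using bound[of i] outside[of i] by (cases "i \<in> E") (auto simp: h_def E_def e_def)
  moreover have "(\<lambda>i. Re (S i)) sums Re (suminf S)" by (intro sums_Re summable_sums S_summable)
  moreover have "h sums (C * suminf e + - (cmod Z)\<^sup>2)"
    unfolding h_def by (intro sums_add sums_mult summable_sums e_summable sums_single[of i0 "\<lambda>_. - (cmod Z)\<^sup>2"])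
  ultimately have "Re (suminf S) \<le> C * suminf e - (cmod Z)\<^sup>2"
    unfolding diff_conv_add_uminus by (rule sums_le)
  also have "\<dots> \<le> C * (8 / c\<^sup>2) - (1 / v\<^sup>2) ^ (m + 1)"
    using Z by (intro diff_mono mult_left_mono e_suminf C)
  also have "\<dots> < 0"
  proof -
    have "(\<tau> - 1 / 2) * c\<^sup>2 = b\<^sup>2 + c\<^sup>2 / 2"
      using \<open>c > 0\<close> by (simp add: \<tau>_def field_simps)
    then have "v\<^sup>2 \<le> (\<tau> - 1 / 2) * c\<^sup>2" using i0 by (simp add: v_def)
    then have "C * (8 / c\<^sup>2) < (1 / v\<^sup>2) ^ (m + 1)"
      unfolding C_def using v
      by (intro far_zeros_dominated[OF tau \<open>c > 0\<close> _ _ z(2) s m]) auto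
    then show ?thesis by simp
  qed
  finally show False using S_nonneg by simp
qed

section \<open>Aperture and comparison of constants\<close>

theorem theorem1p2:
  fixes f :: "complex \<Rightarrow> complex" and d1 d2 :: complex and lam :: "nat \<Rightarrow> complex"
    and N :: nat
  assumes "genus_one_form f d1 d2 lam"
    and "f 0 \<noteq> 0"
    and "N_LP N d2 lam"
  shows "ereal (real N) \<le>
    (if aperture lam = \<infinity> then \<infinity>
     else let \<kappa> = real_of_ereal (aperture lam) in
       ereal (ln (4 * pi\<^sup>2 / 3 + 4) / ln 2
         + pi ^ 3 * sqrt 3 / ln 2 * (\<kappa> + sqrt (1 + \<kappa>\<^sup>2)) ^ 6 * (1 + \<kappa>\<^sup>2) powr (3 / 2)))"
proof (cases "aperture lam = \<infinity>")
  case True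
  then show ?thesis by simp
next
  case False
  then have sp: "spacing lam \<noteq> 0" and ht: "height lam \<noteq> \<infinity>"
    and ap: "aperture lam = height lam / spacing lam"
    by (auto simp: aperture_def split: if_splits)
  have inj: "inj lam" using sp by (auto simp: spacing_def split: if_splits)
  define D where "D = {(i, j). i \<noteq> j \<and> lam i \<noteq> cnj (lam j)}"
  have spacing: "spacing lam = (INF (i, j)\<in>D. ereal \<bar>Re (lam i - lam j)\<bar>)"
    using inj by (simp add: spacing_def D_def)
  have sp_le: "spacing lam \<le> ereal \<bar>Re (lam i - lam j)\<bar>" if "i \<noteq> j" "lam i \<noteq> cnj (lam j)" for i j
    unfolding spacing by (rule INF_lower2[of "(i, j)"]) (use that in \<open>auto simp: D_def\<close>)
  \<comment> \<open>At most one of \<open>lam 1\<close>, \<open>lam 2\<close> is conjugate to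
    \<open>lam 0\<close>, so the infimum is over a nonempty set and the spacing is finite.\<close>
  have "lam 1 \<noteq> lam 2" using inj by (auto dest: injD)
  then have "lam 1 \<noteq> cnj (lam 0) \<or> lam 2 \<noteq> cnj (lam 0)" by auto
  then have "spacing lam < \<infinity>" using sp_le[of 1 0] sp_le[of 2 0] by force
  moreover have "spacing lam \<ge> 0" unfolding spacing by (rule INF_greatest) auto
  ultimately obtain c where c: "spacing lam = ereal c" "c > 0"
    using sp by (cases "spacing lam") auto
  have "height lam \<ge> 0" unfolding height_def by (rule INF_greatest) auto
  then obtain b where b: "height lam = ereal b" "b \<ge> 0"
    using ht by (cases "height lam") auto
  have high: "b \<le> \<bar>Im (lam i)\<bar>" if "Im (lam i) \<noteq> 0" for i
  proof -
    have "height lam \<le> ereal \<bar>Im (lam i)\<bar>"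
      unfolding height_def by (rule INF_lower) (use that in auto)
    then show ?thesis by (simp add: b)
  qed
  \<comment> \<open>The infimum \<open>b\<close> need not be attained; an excess of
    \<open>c^2 / 2\<close> in the square is affordable.\<close>
  have "b\<^sup>2 < b\<^sup>2 + c\<^sup>2 / 2" using c by simp
  then have "b < sqrt (b\<^sup>2 + c\<^sup>2 / 2)" using b by (simp add: real_less_rsqrt)
  then have "height lam < ereal (sqrt (b\<^sup>2 + c\<^sup>2 / 2))" by (simp add: b)
  then obtain i0 where i0: "Im (lam i0) \<noteq> 0" "\<bar>Im (lam i0)\<bar> < sqrt (b\<^sup>2 + c\<^sup>2 / 2)"
    unfolding height_def INF_less_iff by auto
  then have "\<bar>Im (lam i0)\<bar>\<^sup>2 \<le> (sqrt (b\<^sup>2 + c\<^sup>2 / 2))\<^sup>2" by (intro power_mono) auto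
  then have i0_sq: "(Im (lam i0))\<^sup>2 \<le> b\<^sup>2 + c\<^sup>2 / 2" by simp
  define \<kappa> where "\<kappa> = b / c"
  have kappa: "real_of_ereal (aperture lam) = \<kappa>" "\<kappa> \<ge> 0"
    using b c by (auto simp: ap \<kappa>_def)
  define t where "t = sqrt (1 + \<kappa>\<^sup>2)"
  have t: "t \<ge> 1" "t\<^sup>2 = 1 + \<kappa>\<^sup>2" by (auto simp: t_def)
  have "real N \<le> 4 + 60 * (1 + (b / c)\<^sup>2)\<^sup>2"
  proof (rule N_le_of_pos_semidef[OF inj c(2) b(2) _ high i0(1) i0_sq])
    show "c \<le> \<bar>Re (lam i) - Re (lam j)\<bar>" if "i \<noteq> j" "lam i \<noteq> cnj (lam j)" for i j
      using sp_le[OF that] c by simp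
    show "pos_semidef (A_mat lam N x)" if "of_real x \<notin> range lam" for x
      using assms(3) that by (auto simp: N_LP_def)
  qed
  also have "\<dots> = 4 + 60 * t ^ 4" by (simp add: \<kappa>_def[symmetric] t(2)[symmetric])
  also have "\<dots> \<le> ln (4 * pi\<^sup>2 / 3 + 4) / ln 2
      + pi ^ 3 * sqrt 3 / ln 2 * (\<kappa> + t) ^ 6 * (1 + \<kappa>\<^sup>2) powr (3 / 2)"
  proof (rule add_mono)
    \<comment> \<open>\<open>4 * 9 / 3 + 4 = 16 = 2 ^ 4\<close>.\<close>
    have "(3::real) ^ 2 \<le> pi\<^sup>2" using pi_gt3 by (intro power_mono) auto
    then have "ln (2 ^ 4) \<le> ln (4 * pi\<^sup>2 / 3 + 4)" by (subst ln_le_cancel_iff) (auto intro: add_nonneg_pos)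
    moreover have "ln (2 ^ 4 :: real) = 4 * ln 2" by (subst ln_realpow) auto
    ultimately show "4 \<le> ln (4 * pi\<^sup>2 / 3 + 4) / ln 2" by (simp only: le_divide_eq ln_gt_zero_iff) simp
    \<comment> \<open>\<open>27 * 1.7 = 45.9\<close> exceeds \<open>60 * 25 / 36\<close>, an upper
      bound for \<open>60 * ln 2\<close>.\<close>
    have "(3::real) ^ 3 \<le> pi ^ 3" using pi_gt3 by (intro power_mono) auto
    moreover have "17 / 10 \<le> sqrt 3" by (rule real_le_rsqrt) (simp add: power2_eq_square)
    ultimately have "27 * (17 / 10) \<le> pi ^ 3 * sqrt 3" by (intro mult_mono) auto
    moreover have "60 * ln 2 \<le> 27 * (17 / 10 :: real)" using ln2_le_25_over_36 by simp
    ultimately have 1: "60 \<le> pi ^ 3 * sqrt 3 / ln 2" by (simp add: le_divide_eq)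
    have "t ^ 4 \<le> t ^ 6" using t by (intro power_increasing) auto
    also have "\<dots> \<le> (\<kappa> + t) ^ 6" using kappa t by (intro power_mono) auto
    finally have 2: "t ^ 4 \<le> (\<kappa> + t) ^ 6" .
    have 3: "1 \<le> (1 + \<kappa>\<^sup>2) powr (3 / 2)" by (rule ge_one_powr_ge_zero) auto
    have "60 * t ^ 4 * 1 \<le> pi ^ 3 * sqrt 3 / ln 2 * (\<kappa> + t) ^ 6 * (1 + \<kappa>\<^sup>2) powr (3 / 2)"
      using t kappa by (intro mult_mono 1 2 3) auto
    then show "60 * t ^ 4 \<le> pi ^ 3 * sqrt 3 / ln 2 * (\<kappa> + t) ^ 6 * (1 + \<kappa>\<^sup>2) powr (3 / 2)"
      by simp
  qed
  finally show ?thesis using False by (simp add: kappa t_def)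
qed

end
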